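(* Let $c,d\in\mathbb{N}$, $I=\mathbb{N}^d\times[c]$, $I_n=[n]^d\times[c]$. Let $\mathfrak{L}=(L_n)_{n\ge1}$ be a $\mathrm{Sym}$-invariant chain of lattices with limit $L=\bigcup_{n\ge1}L_n$. Then the following are equivalent: (i) $\mathfrak{L}$ stabilizes, i.e. there is $p\in\mathbb{N}$ with $L_n=\mathbb{Z}\,\mathrm{Sym}(n)(L_m)$ for all $n\ge m\ge p$; (ii) there exist $p\in\mathbb{N}$ and an equivariant generating set $\mathcal{B}_p$ of $L_p$ such that $\mathcal{B}_p$ is also an equivariant generating set of $L_n$ for all $n\ge p$; (iii) there exist $q,q'\in\mathbb{N}$ such that for all $n\ge q$: (a) $L_n=L\cap\mathbb{Z}^{(I_n)}$, and (b) $L_n$ is generated by elements of support size at most $q'$; (iv) $L$ has a finite equivariant generating set.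
   Context: $\mathbb{N}=\{1,2,\dots\}$, $[n]=\{1,\dots,n\}$. $\mathbb{Z}^{(I)}$ is the free abelian group with basis $I$ (finitely supported integer vectors), with standard basis $\mathbf{e}_{\mathbf{i},j}$; $\mathbb{Z}^{(I_n)}$ is regarded as a subgroup of $\mathbb{Z}^{(I)}$ via extension by zero. A lattice is a subgroup. The support size of $\mathbf{u}$ is the number of indices with nonzero entry. $\mathrm{Sym}(n)$ is the symmetric group on $[n]$, embedded in $\mathrm{Sym}(n+1)$ as the stabilizer of $n+1$; $\mathrm{Sym}=\bigcup_n\mathrm{Sym}(n)$. $\mathrm{Sym}$ acts on $\mathbb{Z}^{(I)}$ by the linear extension of $\sigma(\mathbf{e}_{(i_1,\dots,i_d),j})=\mathbf{e}_{(\sigma(i_1),\dots,\sigma(i_d)),j}$, and this restricts to an action of $\mathrm{Sym}(n)$ on $\mathbb{Z}^{(I_n)}$. For a set $A$ and group $G$, $G(A)=\{\sigma(\mathbf{u})\mid\sigma\in G,\mathbf{u}\in A\}$, and $\mathbb{Z}A$ is the subgroup generated by $A$. A $\mathrm{Sym}$-invariant chain of lattices is a sequence $(L_n)_{n\ge1}$ with $L_n\subseteq\mathbb{Z}^{(I_n)}$ a lattice, $L_m\subseteq L_n$ for $m\le n$, and each $L_n$ being $\mathrm{Sym}(n)$-invariant. For a $\mathrm{Sym}(n)$-invariant lattice $L_n\subseteq\mathbb{Z}^{(I_n)}$ (resp. $\mathrm{Sym}$-invariant lattice $L\subseteq\mathbb{Z}^{(I)}$), $\mathcal{B}\subseteq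 L_n$ is an equivariant generating set if $\mathrm{Sym}(n)(\mathcal{B})$ (resp. $\mathrm{Sym}(\mathcal{B})$) generates it as an abelian group. *)

theory Defs
  imports "HOL-Combinatorics.Permutations" "HOL-Library.Function_Algebras"
begin

text \<open>Indices (i_1,...,i_d), j are represented as pairs (list of length d, j).
  Integer vectors in Z^(I) are functions from indices to int with finite support
  contained in I.\<close>

type_synonym idx = "nat list \<times> nat"
type_synonym zvec = "idx \<Rightarrow> int"

definition Idx :: "nat \<Rightarrow> nat \<Rightarrow> idx set" where
  "Idx d c = {(is, j). length is = d \<and> set is \<subseteq> {1..} \<and> j \<in> {1..c}}"

definition Idx_n :: "nat \<Rightarrow> nat \<Rightarrow> nat \<Rightarrow> idx set" where
  "Idx_n d c n = {(is, j). length is = d \<and> set is \<subseteq> {1..n} \<and> j \<in> {1..c}}"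

definition supp :: "zvec \<Rightarrow> idx set" where
  "supp u = {x. u x \<noteq> 0}"

definition supp_size :: "zvec \<Rightarrow> nat" where
  "supp_size u = card (supp u)"

definition ZI :: "nat \<Rightarrow> nat \<Rightarrow> zvec set" where
  "ZI d c = {u. finite (supp u) \<and> supp u \<subseteq> Idx d c}"

definition ZIn :: "nat \<Rightarrow> nat \<Rightarrow> nat \<Rightarrow> zvec set" where
  "ZIn d c n = {u. supp u \<subseteq> Idx_n d c n}"

definition Sym :: "nat \<Rightarrow> (nat \<Rightarrow> nat) set" where
  "Sym n = {\<sigma>. \<sigma> permutes {1..n}}"

definition SymAll :: "(nat \<Rightarrow> nat) set" where
  "SymAll = (\<Union>n\<in>{1..}. Sym n)"

text \<open>Action: sigma(e_{(i_1..i_d),j}) = e_{(sigma i_1..sigma i_d),j}, extended linearly,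
  i.e. (sigma u)(k, j) = u(sigma^{-1} k, j).\<close>
definition act :: "(nat \<Rightarrow> nat) \<Rightarrow> zvec \<Rightarrow> zvec" where
  "act \<sigma> u = (\<lambda>(is, j). u (map (inv \<sigma>) is, j))"

definition orbit :: "(nat \<Rightarrow> nat) set \<Rightarrow> zvec set \<Rightarrow> zvec set" where
  "orbit G A = {act \<sigma> u | \<sigma> u. \<sigma> \<in> G \<and> u \<in> A}"

inductive_set zspan :: "zvec set \<Rightarrow> zvec set" for A where
  zero: "0 \<in> zspan A"
| gen: "u \<in> A \<Longrightarrow> u \<in> zspan A"
| add: "u \<in> zspan A \<Longrightarrow> v \<in> zspan A \<Longrightarrow> u + v \<in> zspan A"
| neg: "u \<in> zspan A \<Longrightarrow> - u \<in> zspan A"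

definition is_lattice :: "zvec set \<Rightarrow> bool" where
  "is_lattice L \<longleftrightarrow> 0 \<in> L \<and> (\<forall>x\<in>L. \<forall>y\<in>L. x + y \<in> L) \<and> (\<forall>x\<in>L. - x \<in> L)"

definition sym_inv_chain :: "nat \<Rightarrow> nat \<Rightarrow> (nat \<Rightarrow> zvec set) \<Rightarrow> bool" where
  "sym_inv_chain d c L \<longleftrightarrow>
     (\<forall>n\<ge>1. L n \<subseteq> ZIn d c n \<and> is_lattice (L n) \<and>
        (\<forall>\<sigma>\<in>Sym n. \<forall>u\<in>L n. act \<sigma> u \<in> L n)) \<and>
     (\<forall>m n. 1 \<le> m \<longrightarrow> m \<le> n \<longrightarrow> L m \<subseteq> L n)"

definition chain_limit :: "(nat \<Rightarrow> zvec set) \<Rightarrow> zvec set" where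
  "chain_limit L = (\<Union>n\<in>{1..}. L n)"

definition eq_gen_set_n :: "nat \<Rightarrow> zvec set \<Rightarrow> zvec set \<Rightarrow> bool" where
  "eq_gen_set_n n B M \<longleftrightarrow> B \<subseteq> M \<and> zspan (orbit (Sym n) B) = M"

definition eq_gen_set :: "zvec set \<Rightarrow> zvec set \<Rightarrow> bool" where
  "eq_gen_set B M \<longleftrightarrow> B \<subseteq> M \<and> zspan (orbit SymAll B) = M"

end

theory Submission
  imports Defs "HOL-Library.List_Lexorder" "HOL-Library.Product_Lexorder"
begin

text \<open>All four conditions hold for every Sym-invariant chain, by a Groebner basis argument. Order
  the indices by largest entry first, then lexicographically; this order is compatible with strictly
  increasing maps. By Dickson's lemma the pairs (leading index, positive leading coefficient) of
  elements of the limit have finitely many minimal elements, where one pair is below another if a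
  strictly increasing map carries the first index to the second and the coefficients are
  ordered by size. Since such a map extends to a permutation, subtracting translates of the
  corresponding finitely many vectors reduces every element of \<open>L n\<close> to zero, for \<open>n\<close> large.\<close>

section \<open>Dickson's lemma, increasing maps, and extension to permutations\<close>

text \<open>Induction on \<open>F\<close>. A basis for the smaller family already lies below every
  element whose new coordinate g is at least the maximum M of g on that basis. The remaining
  elements fall into the finitely many slices g = a with a < M, and on a slice the new coordinate is
  constant, so the induction hypothesis for that slice suffices.\<close>

lemma dickson:
  fixes F :: "('a \<Rightarrow> nat) set"
  assumes "finite F"
  shows "\<exists>B\<subseteq>S. finite B \<and> (\<forall>x\<in>S. \<exists>b\<in>B. \<forall>f\<in>F. f b \<le> f x)"
  using assms
proof (induction F arbitrary: S rule: finite_induct)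
  case empty
  show ?case
  proof (cases "S = {}")
    case False
    then obtain s where "s \<in> S" by blast
    then show ?thesis by (intro exI[of _ "{s}"]) auto
  qed auto
next
  case (insert g F)
  obtain B where B: "B \<subseteq> S" "finite B" "\<And>x. x \<in> S \<Longrightarrow> \<exists>b\<in>B. \<forall>f\<in>F. f b \<le> f x"
    using insert.IH[of S] by metis
  have "\<forall>a. \<exists>C\<subseteq>{x\<in>S. g x = a}. finite C \<and> (\<forall>x\<in>{x\<in>S. g x = a}. \<exists>b\<in>C. \<forall>f\<in>F. f b \<le> f x)"
    using insert.IH by blast
  from choice[OF this] obtain C where "\<forall>a. C a \<subseteq> {x\<in>S. g x = a} \<and> finite (C a) \<and>
      (\<forall>x\<in>{x\<in>S. g x = a}. \<exists>b\<in>C a. \<forall>f\<in>F. f b \<le> f x)"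
    by (elim exE)
  then have C: "\<And>a. C a \<subseteq> {x\<in>S. g x = a}" "\<And>a. finite (C a)"
    "\<And>a x. x \<in> S \<Longrightarrow> g x = a \<Longrightarrow> \<exists>b\<in>C a. \<forall>f\<in>F. f b \<le> f x"
    by simp_all
  \<comment> \<open>Inserting 0 keeps \<open>Max\<close> meaningful when \<open>B\<close> is
    empty.\<close>
  define M where "M = Max (insert 0 (g ` B))"
  have M: "g b \<le> M" if "b \<in> B" for b
    using that B(2) by (simp add: M_def)
  define D where "D = B \<union> (\<Union>a<M. C a)"
  have "\<exists>b\<in>D. \<forall>f\<in>insert g F. f b \<le> f x" if x: "x \<in> S" for x
  proof (cases "g x < M")
    case True
    obtain b where b: "b \<in> C (g x)" "\<forall>f\<in>F. f b \<le> f x" using C(3)[OF x refl] by blast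
    moreover have "g b = g x" using C(1) b(1) by blast
    ultimately show ?thesis using True unfolding D_def by (intro bexI[of _ b]) auto
  next
    case False
    obtain b where b: "b \<in> B" "\<forall>f\<in>F. f b \<le> f x" using B(3)[OF x] by blast
    moreover have "g b \<le> g x" using False M[OF b(1)] by linarith
    ultimately show ?thesis unfolding D_def by (intro bexI[of _ b]) auto
  qed
  moreover have "D \<subseteq> S" using B(1) C(1) unfolding D_def by blast
  moreover have "finite D" using B(2) C(2) by (simp add: D_def)
  ultimately show ?case by blast
qed

text \<open>The hypothesis says that gaps between entries do not shrink (and equal entries stay equal);
  \<open>Suc\<close> makes the truncated difference distinguish equality from the opposite order.\<close>

lemma strict_mono_carrying_list:
  fixes z z' :: "nat list"
  assumes "length z' = length z" "0 \<in> set z"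
    and gaps: "\<And>a b. a < length z \<Longrightarrow> b < length z \<Longrightarrow> Suc (z ! b) - z ! a \<le> Suc (z' ! b) - z' ! a"
  shows "\<exists>\<pi>::nat \<Rightarrow> nat. strict_mono \<pi> \<and> map \<pi> z = z'"
proof -
  \<comment> \<open>A strictly increasing map sending \<open>z ! a\<close> to \<open>z' ! a\<close>
    is at least \<open>z' ! a + (x - z ! a)\<close> at every x from \<open>z ! a\<close> on.
    \<open>\<pi>\<close> takes the largest of these lower bounds; the entry 0 of z supplies at least
    one bound at every x.\<close>
  define A where "A = (\<lambda>x. {z' ! a + (x - z ! a) | a. a < length z \<and> z ! a \<le> x})"
  define \<pi> where "\<pi> = (\<lambda>x. Max (A x))"
  obtain i where i: "i < length z" "z ! i = 0" using assms(2) by (auto simp: in_set_conv_nth)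
  have fin: "finite (A x)" for x unfolding A_def by simp
  have A: "z' ! a + (x - z ! a) \<in> A x" if "a < length z" "z ! a \<le> x" for a x
    using that unfolding A_def by blast
  have ne: "A x \<noteq> {}" for x using A[of i x] i by auto
  have "\<pi> x < \<pi> y" if "x < y" for x y
  proof -
    have "\<pi> x \<in> A x" unfolding \<pi>_def by (rule Max_in[OF fin ne])
    then obtain a where a: "a < length z" "z ! a \<le> x" "\<pi> x = z' ! a + (x - z ! a)"
      unfolding A_def by blast
    then have "z' ! a + (y - z ! a) \<in> A y" using that by (intro A) auto
    then have "z' ! a + (y - z ! a) \<le> \<pi> y" unfolding \<pi>_def using fin by simp
    then show ?thesis using a that by linarith
  qed
  then have "strict_mono \<pi>" by (simp add: strict_mono_def)
  moreover have "map \<pi> z = z'"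
  proof (rule nth_equalityI)
    fix b assume "b < length (map \<pi> z)"
    then have b: "b < length z" by simp
    have "\<pi> (z ! b) = z' ! b" unfolding \<pi>_def
    proof (rule Max_eqI[OF fin])
      show "z' ! b \<in> A (z ! b)" using A[OF b order_refl] by simp
      fix y assume "y \<in> A (z ! b)"
      then obtain a where a: "a < length z" "z ! a \<le> z ! b" "y = z' ! a + (z ! b - z ! a)"
        unfolding A_def by blast
      \<comment> \<open>Since \<open>z ! a \<le> z ! b\<close>, the left side of the gap inequality
        is positive, so neither difference is truncated and the bound coming from a does not exceed
        \<open>z' ! b\<close>.\<close>
      then show "y \<le> z' ! b" using gaps[OF a(1) b] by linarith
    qed
    then show "map \<pi> z ! b = z' ! b" using b by simp
  qed (simp add: assms(1))
  ultimately show ?thesis by blast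
qed

text \<open>In a finite set, A and its injective image have complements of equal size, so any
  bijection between the complements completes f.\<close>

lemma inj_on_extends_to_permutation:
  assumes "finite B" "A \<subseteq> B" "inj_on f A" "f ` A \<subseteq> B"
  shows "\<exists>p. p permutes B \<and> (\<forall>x\<in>A. p x = f x)"
proof -
  have "finite A" using assms finite_subset by blast
  have "card (B - A) = card (B - f ` A)"
    using assms \<open>finite A\<close> by (simp add: card_Diff_subset card_image)
  then obtain h where h: "bij_betw h (B - A) (B - f ` A)"
    using assms(1) finite_same_card_bij[of "B - A" "B - f ` A"] by blast
  define p where "p = (\<lambda>x. if x \<in> A then f x else if x \<in> B then h x else x)"
  have "bij_betw p A (f ` A)"
    using assms(3) by (simp add: p_def bij_betw_def inj_on_def)
  moreover have "bij_betw p (B - A) (B - f ` A)"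
    using h by (rule bij_betw_cong[THEN iffD1, rotated]) (simp add: p_def)
  ultimately have "bij_betw p (A \<union> (B - A)) (f ` A \<union> (B - f ` A))"
    by (rule bij_betw_combine) blast
  moreover have "A \<union> (B - A) = B" "f ` A \<union> (B - f ` A) = B" using assms by auto
  ultimately have "p permutes B"
    using assms(2) by (intro bij_imp_permutes) (auto simp: p_def)
  then show ?thesis by (auto simp: p_def)
qed

section \<open>The ordering of indices and its behaviour under increasing maps\<close>

lemma map_less_map:
  fixes f :: "'a::linorder \<Rightarrow> 'b::linorder"
  assumes "strict_mono_on A f" "set xs \<subseteq> A" "set ys \<subseteq> A" "xs < ys"
  shows "map f xs < map f ys"
  using assms(2-)
proof (induction xs arbitrary: ys)
  case Nil
  then show ?case by (cases ys) auto
next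
  case (Cons x xs)
  then show ?case using assms(1) by (cases ys) (auto simp: strict_mono_on_def)
qed

lemma Max_image_strict_mono_on:
  fixes f :: "'a::linorder \<Rightarrow> 'b::linorder"
  assumes "strict_mono_on A f" "S \<subseteq> A" "finite S" "S \<noteq> {}"
  shows "Max (f ` S) = f (Max S)"
proof (rule Max_eqI)
  fix y assume "y \<in> f ` S"
  then obtain x where x: "x \<in> S" "y = f x" by blast
  then have "x \<le> Max S" using assms by simp
  moreover have "Max S \<in> S" using assms by simp
  ultimately show "y \<le> f (Max S)"
    using assms(1,2) x strict_mono_on_leD[of A f x "Max S"] by blast
qed (use assms in auto)

text \<open>The prefixed 0 gives the empty list a maximum. It changes nothing for other lists of
  natural numbers, and permutations in \<open>Sym n\<close> fix 0, so the maximum still commutes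
  with increasing ones.\<close>

definition top_entry :: "nat list \<Rightarrow> nat" where
  "top_entry is = Max (set (0 # is))"

text \<open>Comparing the largest entry first bounds all entries of all support indices of a vector
  by the largest entry of its leading index.\<close>

definition idx_key :: "idx \<Rightarrow> nat list \<times> nat" where
  "idx_key = (\<lambda>(is, j). (top_entry is # is, j))"

definition is_lead :: "zvec \<Rightarrow> idx \<Rightarrow> bool" where
  "is_lead u x \<longleftrightarrow> x \<in> supp u \<and> (\<forall>y\<in>supp u. idx_key y \<le> idx_key x)"

definition move :: "(nat \<Rightarrow> nat) \<Rightarrow> idx \<Rightarrow> idx" where
  "move \<sigma> = (\<lambda>(is, j). (map \<sigma> is, j))"

lemma idx_key_eq_iff: "idx_key x = idx_key y \<longleftrightarrow> x = y"
  by (cases x; cases y) (auto simp: idx_key_def)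

lemma set_le_top_entry: "set is \<subseteq> {0..top_entry is}"
  by (auto simp: top_entry_def)

lemma top_entry_map:
  assumes "strict_mono_on {0..m} \<sigma>" "\<sigma> 0 = 0" "set is \<subseteq> {0..m}"
  shows "top_entry (map \<sigma> is) = \<sigma> (top_entry is)"
  using Max_image_strict_mono_on[OF assms(1), of "set (0 # is)"] assms(2,3)
  by (simp add: top_entry_def)

text \<open>An increasing map commutes with taking the largest entry, so the list part of the key of
  the moved index is the image of the old list part, entry by entry. Such images preserve the
  lexicographic order, and the label j is untouched.\<close>

lemma idx_key_move_le:
  assumes "strict_mono_on {0..m} \<sigma>" "\<sigma> 0 = 0" "set (fst x) \<subseteq> {0..m}" "set (fst y) \<subseteq> {0..m}"
    and "idx_key x \<le> idx_key y"
  shows "idx_key (move \<sigma> x) \<le> idx_key (move \<sigma> y)"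
proof -
  obtain xs i where x: "x = (xs, i)" by fastforce
  obtain ys j where y: "y = (ys, j)" by fastforce
  have key: "idx_key (move \<sigma> (zs, k)) = (map \<sigma> (top_entry zs # zs), k)" if "set zs \<subseteq> {0..m}" for zs k
    using top_entry_map[OF assms(1,2) that] by (simp add: idx_key_def move_def)
  have sub: "set (top_entry zs # zs) \<subseteq> {0..m}" if "set zs \<subseteq> {0..m}" for zs
    using that by (auto simp: top_entry_def)
  have "top_entry xs # xs < top_entry ys # ys \<or> top_entry xs # xs = top_entry ys # ys \<and> i \<le> j"
    using assms(5) unfolding x y idx_key_def less_eq_prod_def by auto
  moreover have "map \<sigma> (top_entry xs # xs) < map \<sigma> (top_entry ys # ys)"
    if "top_entry xs # xs < top_entry ys # ys"
    using map_less_map[OF assms(1) sub sub that] assms(3,4) x y by simp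
  ultimately show ?thesis
    using assms(3,4) unfolding x y by (auto simp: key simp del: list.map Cons_less_Cons)
qed

section \<open>The action on supports and leading indices\<close>

lemma act_move:
  assumes "\<sigma> \<in> Sym n"
  shows "act \<sigma> u (move \<sigma> x) = u x"
proof -
  have "\<sigma> permutes {1..n}" using assms by (simp add: Sym_def)
  then have "inv \<sigma> \<circ> \<sigma> = id" by (rule permutes_inv_o)
  then show ?thesis by (cases x) (simp add: act_def move_def)
qed

lemma supp_act:
  assumes "\<sigma> \<in> Sym n"
  shows "supp (act \<sigma> u) = move \<sigma> ` supp u"
proof
  show "move \<sigma> ` supp u \<subseteq> supp (act \<sigma> u)"
    using act_move[OF assms] by (auto simp: supp_def)
  have "\<sigma> permutes {1..n}" using assms by (simp add: Sym_def)
  then have "\<sigma> \<circ> inv \<sigma> = id" by (rule permutes_inv_o)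
  then have m: "x = move \<sigma> (move (inv \<sigma>) x)" for x
    by (cases x) (simp add: move_def)
  show "supp (act \<sigma> u) \<subseteq> move \<sigma> ` supp u"
  proof
    fix x assume "x \<in> supp (act \<sigma> u)"
    then have "move (inv \<sigma>) x \<in> supp u"
      using act_move[OF assms, of u "move (inv \<sigma>) x"] m[of x] by (simp add: supp_def)
    then show "x \<in> move \<sigma> ` supp u" using m by blast
  qed
qed

lemma supp_size_act_le:
  assumes "\<sigma> \<in> Sym n" "finite (supp u)"
  shows "supp_size (act \<sigma> u) \<le> supp_size u"
  unfolding supp_size_def supp_act[OF assms(1)] using assms(2) by (rule card_image_le)

lemma act_in_ZIn:
  assumes "\<sigma> \<in> Sym n" "u \<in> ZIn d c n"
  shows "act \<sigma> u \<in> ZIn d c n"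
proof -
  have "\<sigma> permutes {1..n}" using assms by (simp add: Sym_def)
  then have "\<sigma> ` {1..n} = {1..n}" by (rule permutes_image)
  then have "move \<sigma> ` Idx_n d c n \<subseteq> Idx_n d c n"
    by (fastforce simp: move_def Idx_n_def)
  then show ?thesis
    using assms by (auto simp: ZIn_def supp_act[OF assms(1)])
qed

text \<open>Only the identity in \<open>Sym n\<close> is increasing on all of [n], so monotonicity
  can be demanded only on an initial interval. This interval is long enough: the key order confines
  every entry occurring in the support of u to it.\<close>

lemma is_lead_act:
  assumes "\<sigma> \<in> Sym n" "strict_mono_on {0..top_entry (fst x)} \<sigma>" "is_lead u x"
  shows "is_lead (act \<sigma> u) (move \<sigma> x)"
proof -
  have "\<sigma> permutes {1..n}" using assms by (simp add: Sym_def)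
  then have "\<sigma> 0 = 0" by (rule permutes_not_in) simp
  have sub: "set (fst y) \<subseteq> {0..top_entry (fst x)}" if "y \<in> supp u" for y
  proof -
    have "idx_key y \<le> idx_key x" using assms(3) that by (simp add: is_lead_def)
    then have "top_entry (fst y) \<le> top_entry (fst x)"
      by (cases x; cases y) (auto simp: idx_key_def)
    then show ?thesis using set_le_top_entry[of "fst y"] by auto
  qed
  show ?thesis
    using assms(3) idx_key_move_le[OF assms(2) \<open>\<sigma> 0 = 0\<close> sub sub]
    unfolding is_lead_def supp_act[OF assms(1)] by blast
qed

lemma ex_is_lead:
  assumes "finite (supp u)" "u \<noteq> 0"
  shows "\<exists>x. is_lead u x"
proof -
  have "supp u \<noteq> {}" using assms(2) by (auto simp: supp_def)
  then have "Max (idx_key ` supp u) \<in> idx_key ` supp u"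
    using assms(1) by simp
  then obtain x where "x \<in> supp u" "idx_key x = Max (idx_key ` supp u)" by force
  then have "is_lead u x" using assms(1) by (simp add: is_lead_def)
  then show ?thesis by blast
qed

lemma is_lead_uminus: "is_lead (- u) x \<longleftrightarrow> is_lead u x"
  by (simp add: is_lead_def supp_def)

lemma is_lead_diff_le:
  assumes "is_lead u x" "is_lead v x" "is_lead (u - v) y"
  shows "idx_key y \<le> idx_key x"
proof -
  have "y \<in> supp u \<union> supp v" using assms(3) by (auto simp: is_lead_def supp_def)
  then show ?thesis using assms(1,2) by (auto simp: is_lead_def)
qed

section \<open>Lattices, integer spans, and permutations carrying one index to another\<close>

lemma finite_Idx_n: "finite (Idx_n d c n)"
proof -
  have "finite {xs. set xs \<subseteq> {1..n} \<and> length xs = d}" by (rule finite_lists_length_eq) simp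
  moreover have "Idx_n d c n = {xs. set xs \<subseteq> {1..n} \<and> length xs = d} \<times> {1..c}"
    by (auto simp: Idx_n_def)
  ultimately show ?thesis by simp
qed

lemma finite_supp_ZIn: "u \<in> ZIn d c n \<Longrightarrow> finite (supp u)"
  unfolding ZIn_def using finite_Idx_n finite_subset by blast

lemma is_lattice_diff:
  assumes "is_lattice M" "u \<in> M" "v \<in> M"
  shows "u - v \<in> M"
  using assms unfolding is_lattice_def by (metis diff_conv_add_uminus)

lemma zspan_subset_lattice:
  assumes "is_lattice M" "A \<subseteq> M"
  shows "zspan A \<subseteq> M"
proof
  fix u assume "u \<in> zspan A"
  then show "u \<in> M"
    by (induction rule: zspan.induct) (use assms in \<open>unfold is_lattice_def, blast+\<close>)
qed

lemma zspan_mono: "A \<subseteq> B \<Longrightarrow> zspan A \<subseteq> zspan B"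
  by (rule zspan_subset_lattice) (auto simp: is_lattice_def intro: zspan.intros)

lemma orbit_mono: "G \<subseteq> H \<Longrightarrow> A \<subseteq> B \<Longrightarrow> orbit G A \<subseteq> orbit H B"
  unfolding orbit_def by blast

text \<open>The prefixed 0 makes the carrying map \<open>\<pi>\<close> fix 0, so it sends positive
  numbers to positive numbers. It sends the largest entry m of the first index to that of the
  second, which is at most n. Hence \<open>\<pi>\<close> maps {1..m} injectively into {1..n}, and
  this restriction extends to a permutation.\<close>

lemma Sym_moving_idx:
  assumes "length is' = length is" "set is' \<subseteq> {1..n}"
    and gaps: "\<And>a b. a \<le> length is \<Longrightarrow> b \<le> length is \<Longrightarrow>
      Suc ((0 # is) ! b) - (0 # is) ! a \<le> Suc ((0 # is') ! b) - (0 # is') ! a"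
  shows "\<exists>\<sigma>\<in>Sym n. strict_mono_on {0..top_entry is} \<sigma> \<and> map \<sigma> is = is'"
proof -
  have "\<exists>\<pi>. strict_mono \<pi> \<and> map \<pi> (0 # is) = 0 # is'"
    by (rule strict_mono_carrying_list) (auto simp: assms(1) less_Suc_eq_le intro: gaps)
  then obtain \<pi> :: "nat \<Rightarrow> nat" where \<pi>: "strict_mono \<pi>" "\<pi> 0 = 0" "map \<pi> is = is'" by auto
  define m where "m = top_entry is"
  have mono: "strict_mono_on {0..m} \<pi>" using \<pi>(1) by (simp add: strict_mono_on_def strict_mono_def)
  have "\<pi> m = top_entry is'"
    using top_entry_map[OF mono \<pi>(2), of "is"] set_le_top_entry[of "is"] \<pi>(3) by (simp add: m_def)
  also have "\<dots> \<le> n" using assms(2) by (auto simp: top_entry_def)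
  finally have "\<pi> m \<le> n" .
  have "\<pi> ` {1..m} \<subseteq> {1..n}"
  proof
    fix y assume "y \<in> \<pi> ` {1..m}"
    then obtain x where x: "1 \<le> x" "x \<le> m" "y = \<pi> x" by auto
    then have "\<pi> 0 < \<pi> x" using \<pi>(1) by (simp add: strict_mono_less)
    moreover have "\<pi> x \<le> \<pi> m" using x \<pi>(1) by (simp add: strict_mono_less_eq)
    ultimately show "y \<in> {1..n}" using x \<open>\<pi> m \<le> n\<close> \<pi>(2) by simp
  qed
  \<comment> \<open>A strictly increasing map on the natural numbers satisfies
    \<open>m \<le> \<pi> m\<close>.\<close>
  moreover have "m \<le> n" using strict_mono_imp_increasing[OF \<pi>(1), of m] \<open>\<pi> m \<le> n\<close> by linarith
  moreover have "inj_on \<pi> {1..m}" using \<pi>(1) strict_mono_imp_inj_on inj_on_subset by blast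
  ultimately obtain \<sigma> where \<sigma>: "\<sigma> permutes {1..n}" "\<forall>x\<in>{1..m}. \<sigma> x = \<pi> x"
    using inj_on_extends_to_permutation[of "{1..n}" "{1..m}" \<pi>] by auto
  have "\<sigma> 0 = 0" using permutes_not_in[OF \<sigma>(1), of 0] by simp
  then have eq: "\<sigma> x = \<pi> x" if "x \<le> m" for x
    using \<sigma>(2) \<pi>(2) that by (cases "x = 0") auto
  have "map \<sigma> is = is'"
    using \<pi>(3) eq set_le_top_entry[of "is"] by (force simp: m_def)
  moreover have "strict_mono_on {0..m} \<sigma>"
    using mono eq by (auto simp: strict_mono_on_def)
  ultimately show ?thesis using \<sigma>(1) by (auto simp: Sym_def m_def)
qed

section \<open>Chains of lattices and finite equivariant generation by reduction\<close>

lemma sym_inv_chainD: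
  assumes "sym_inv_chain d c L"
  shows "n \<ge> 1 \<Longrightarrow> L n \<subseteq> ZIn d c n" "n \<ge> 1 \<Longrightarrow> is_lattice (L n)"
    "n \<ge> 1 \<Longrightarrow> \<sigma> \<in> Sym n \<Longrightarrow> u \<in> L n \<Longrightarrow> act \<sigma> u \<in> L n"
    "1 \<le> m \<Longrightarrow> m \<le> n \<Longrightarrow> L m \<subseteq> L n"
  using assms unfolding sym_inv_chain_def by blast+

lemma zspan_orbit_subset:
  assumes "sym_inv_chain d c L" "n \<ge> 1" "A \<subseteq> L n"
  shows "zspan (orbit (Sym n) A) \<subseteq> L n"
  using assms sym_inv_chainD(2,3)[OF assms(1)]
  by (intro zspan_subset_lattice) (auto simp: orbit_def)

lemma finite_subset_chain_limit:
  assumes "sym_inv_chain d c L" "finite B" "B \<subseteq> chain_limit L"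
  shows "\<exists>p\<ge>1. B \<subseteq> L p"
  using assms(2,3)
proof (induction rule: finite_induct)
  case (insert u B)
  then obtain p where p: "p \<ge> 1" "B \<subseteq> L p" by blast
  obtain m where m: "m \<ge> 1" "u \<in> L m" using insert.prems by (auto simp: chain_limit_def)
  have "L p \<subseteq> L (max p m)" "L m \<subseteq> L (max p m)"
    using sym_inv_chainD(4)[OF assms(1)] p m by auto
  then show ?case using p m by (intro exI[of _ "max p m"]) auto
qed auto

text \<open>This is division with integer coefficients. Subtracting w may leave the leading index in
  place, but then 0 < w x and w x \<le> u x make the leading coefficient strictly smaller; otherwise
  the leading index drops. Induction is on the lexicographic pair of leading index and absolute
  leading coefficient.\<close>

lemma zspan_if_leads_reducible:
  assumes "is_lattice M" "M \<subseteq> ZIn d c n" "A \<subseteq> M"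
    and red: "\<And>u x. u \<in> M \<Longrightarrow> is_lead u x \<Longrightarrow> u x > 0 \<Longrightarrow>
      \<exists>w\<in>A. is_lead w x \<and> 0 < w x \<and> w x \<le> u x"
    and "u \<in> M"
  shows "u \<in> zspan A"
proof -
  \<comment> \<open>Counting the smaller indices in the finite set \<open>Idx_n d c n\<close> turns
    the key order into a natural-number measure.\<close>
  define rank where "rank x = card {y \<in> Idx_n d c n. idx_key y < idx_key x}" for x
  have rank: "rank y < rank x" if "idx_key y < idx_key x" "y \<in> Idx_n d c n" for x y
    unfolding rank_def using that finite_Idx_n by (intro psubset_card_mono) (auto intro: order_less_trans)
  have zero: "0 \<in> zspan A" by (rule zspan.zero)
  have "u \<in> zspan A" if "u \<in> M" "is_lead u x" for u x
    using that
  proof (induction "(u, x)" arbitrary: u x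
      rule: wf_induct_rule[OF wf_measures[of "[\<lambda>(u, x). rank x, \<lambda>(u, x). nat \<bar>u x\<bar>]"]])
    case 1
    \<comment> \<open>Reducers are available only for positive leading coefficients, so the sign of
      u is normalised here and restored at the end by \<open>zspan.neg\<close>.\<close>
    define t where "t = (if u x > 0 then u else - u)"
    have "u x \<noteq> 0" using "1.prems" by (simp add: is_lead_def supp_def)
    then have t: "t \<in> M" "is_lead t x" "t x > 0" "\<bar>u x\<bar> = t x"
      using "1.prems" assms(1) by (auto simp: t_def is_lead_uminus is_lattice_def)
    obtain w where w: "w \<in> A" "is_lead w x" "0 < w x" "w x \<le> t x"
      using red[OF t(1-3)] by blast
    have tw: "t - w \<in> M" using is_lattice_diff[OF assms(1) t(1)] w(1) assms(3) by blast
    have "t - w \<in> zspan A"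
    proof (cases "t - w = 0")
      case False
      then obtain y where y: "is_lead (t - w) y"
        using ex_is_lead finite_supp_ZIn tw assms(2) by blast
      have "y \<in> Idx_n d c n"
        using y tw assms(2) by (auto simp: is_lead_def ZIn_def)
      have "idx_key y \<le> idx_key x" using is_lead_diff_le[OF t(2) w(2) y] .
      then have "((t - w, y), (u, x)) \<in> measures [\<lambda>(u, x). rank x, \<lambda>(u, x). nat \<bar>u x\<bar>]"
      proof (cases "y = x")
        case True
        then show ?thesis using t w by simp
      next
        case False
        then have "idx_key y < idx_key x"
          using \<open>idx_key y \<le> idx_key x\<close> idx_key_eq_iff by (simp add: order_less_le)
        then show ?thesis using rank \<open>y \<in> Idx_n d c n\<close> by simp
      qed
      then show ?thesis using "1.hyps" tw y by blast
    qed (simp add: zero)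
    then have "(t - w) + w \<in> zspan A" using w(1) zspan.add zspan.gen by blast
    then have "t \<in> zspan A" by simp
    then show ?case using zspan.neg[of t A] by (auto simp: t_def split: if_splits)
  qed
  moreover have "u = 0 \<or> (\<exists>x. is_lead u x)"
    using ex_is_lead finite_supp_ZIn assms(2,5) by blast
  ultimately show ?thesis using assms(5) zero by blast
qed

text \<open>The minimal pairs are chosen in the limit, which is what makes one set \<open>B\<close>
  serve all large n. Once \<open>B\<close> lies in \<open>L p\<close>, its translates under
  \<open>Sym n\<close> lie in \<open>L n\<close> for n \<ge> p, so the reduction of an element of
  \<open>L n\<close> never leaves \<open>L n\<close>.\<close>

lemma finite_equivariant_generation:
  assumes "sym_inv_chain d c L"
  shows "\<exists>p\<ge>1. \<exists>B. finite B \<and> B \<subseteq> L p \<and> (\<forall>n\<ge>p. L n = zspan (orbit (Sym n) B))"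
proof -
  note chain = sym_inv_chainD[OF assms]
  define S where "S = {(u, x). u \<in> chain_limit L \<and> is_lead u x \<and> u x > 0}"
  define gap where "gap = (\<lambda>(a, b) (u :: zvec, x :: idx).
    Suc ((0 # fst x) ! b) - (0 # fst x) ! a)"
  \<comment> \<open>Comparing both j and c - j forces equal labels, since labels are at most c.
    Leading coefficients in \<open>S\<close> are positive, so \<open>nat\<close> loses nothing. The
    gaps, taken in the list with 0 prefixed and hence at positions 0 to d, are the hypothesis of
    \<open>Sym_moving_idx\<close>.\<close>
  define F where "F = {\<lambda>(u, x). nat (u x), \<lambda>(u, x). snd x, \<lambda>(u, x). c - snd x}
    \<union> gap ` ({..d} \<times> {..d})"
  have "finite F" unfolding F_def by simp
  then obtain C where C: "C \<subseteq> S" "finite C" "\<And>s. s \<in> S \<Longrightarrow> \<exists>b\<in>C. \<forall>f\<in>F. f b \<le> f s"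
    using dickson[of F S] by metis
  define B where "B = fst ` C"
  have "finite B" "B \<subseteq> chain_limit L" using C by (auto simp: B_def S_def)
  then obtain p where p: "p \<ge> 1" "B \<subseteq> L p" using finite_subset_chain_limit[OF assms] by blast
  have "L n = zspan (orbit (Sym n) B)" if n: "n \<ge> p" for n
  proof
    have n1: "n \<ge> 1" using n p by simp
    have sub: "B \<subseteq> L n" using p n chain(4) by blast
    show "zspan (orbit (Sym n) B) \<subseteq> L n" by (rule zspan_orbit_subset[OF assms n1 sub])
    show "L n \<subseteq> zspan (orbit (Sym n) B)"
    proof
      fix u0 assume "u0 \<in> L n"
      show "u0 \<in> zspan (orbit (Sym n) B)"
      proof (rule zspan_if_leads_reducible[OF chain(2,1)[OF n1 ] _ _ \<open>u0 \<in> L n\<close>])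
        show "orbit (Sym n) B \<subseteq> L n" using sub chain(3)[OF n1] unfolding orbit_def by blast
        fix u x assume u: "u \<in> L n" "is_lead u x" "u x > 0"
        obtain xs i where x: "x = (xs, i)" by fastforce
        have "u \<in> chain_limit L" using u(1) n1 unfolding chain_limit_def by blast
        then have "(u, x) \<in> S" using u by (simp add: S_def)
        then obtain v y where vy: "(v, y) \<in> C" "\<forall>f\<in>F. f (v, y) \<le> f (u, x)"
          using C(3) by (metis surj_pair)
        obtain ys j where y: "y = (ys, j)" by fastforce
        have "(v, y) \<in> S" using vy(1) C(1) by blast
        then have v: "is_lead v y" "v y > 0" by (simp_all add: S_def)
        have "v \<in> B" using vy(1) unfolding B_def by force
        have vx: "nat (v y) \<le> nat (u x)" "j \<le> i" "c - j \<le> c - i"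
          using vy(2) by (simp_all add: F_def x y)
        have "x \<in> Idx_n d c n" "y \<in> Idx_n d c n"
          using u v \<open>v \<in> B\<close> sub chain(1)[OF n1] unfolding is_lead_def ZIn_def by blast+
        then have idx: "length xs = d" "set xs \<subseteq> {1..n}" "i \<le> c" "length ys = d" "j \<le> c"
          by (auto simp: Idx_n_def x y)
        have "i = j" using vx idx by linarith
        have gaps: "Suc ((0 # ys) ! b) - (0 # ys) ! a \<le> Suc ((0 # xs) ! b) - (0 # xs) ! a"
          if "a \<le> d" "b \<le> d" for a b
        proof -
          have "gap (a, b) \<in> F" using that unfolding F_def by blast
          then have "gap (a, b) (v, y) \<le> gap (a, b) (u, x)" using vy(2) by blast
          then show ?thesis by (simp add: gap_def x y)
        qed
        obtain \<sigma> where \<sigma>: "\<sigma> \<in> Sym n" "strict_mono_on {0..top_entry ys} \<sigma>" "map \<sigma> ys = xs"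
          using Sym_moving_idx[of xs ys n] idx gaps by auto
        have "move \<sigma> y = x" using \<sigma>(3) \<open>i = j\<close> by (simp add: move_def x y)
        then have "is_lead (act \<sigma> v) x" "act \<sigma> v x = v y"
          using is_lead_act[OF \<sigma>(1) _ v(1)] act_move[OF \<sigma>(1), of v y] \<sigma>(2) by (auto simp: y)
        moreover have "act \<sigma> v \<in> orbit (Sym n) B" using \<sigma>(1) \<open>v \<in> B\<close> unfolding orbit_def by blast
        ultimately show "\<exists>w\<in>orbit (Sym n) B. is_lead w x \<and> 0 < w x \<and> w x \<le> u x"
          using v(2) vx(1) u(3) by (intro bexI[of _ "act \<sigma> v"]) auto
      qed
    qed
  qed
  then have "\<forall>n\<ge>p. L n = zspan (orbit (Sym n) B)" by simp
  with p \<open>finite B\<close> show ?thesis by (intro exI[of _ p] exI[of _ B] conjI)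
qed

section \<open>The limit lattice and saturation of the chain\<close>

lemma is_lattice_chain_limit:
  assumes "sym_inv_chain d c L"
  shows "is_lattice (chain_limit L)"
proof -
  note chain = sym_inv_chainD[OF assms]
  have "u + v \<in> chain_limit L" if "u \<in> chain_limit L" "v \<in> chain_limit L" for u v
  proof -
    have "\<exists>p\<ge>1. {u, v} \<subseteq> L p"
      using that by (intro finite_subset_chain_limit[OF assms]) auto
    then obtain p where p: "p \<ge> 1" "u \<in> L p" "v \<in> L p" by auto
    then have "u + v \<in> L p" using chain(2)[of p] by (simp add: is_lattice_def)
    then show ?thesis using p(1) unfolding chain_limit_def by blast
  qed
  moreover have "- u \<in> chain_limit L" if "u \<in> chain_limit L" for u
    using that chain(2) unfolding chain_limit_def is_lattice_def by blast
  moreover have "0 \<in> chain_limit L"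
    using chain(2)[of 1] unfolding chain_limit_def is_lattice_def by auto
  ultimately show ?thesis unfolding is_lattice_def by blast
qed

lemma act_in_chain_limit:
  assumes "sym_inv_chain d c L" "\<sigma> \<in> Sym n" "u \<in> chain_limit L"
  shows "act \<sigma> u \<in> chain_limit L"
proof -
  note chain = sym_inv_chainD[OF assms(1)]
  obtain m where m: "m \<ge> 1" "u \<in> L m" using assms(3) by (auto simp: chain_limit_def)
  have "\<sigma> permutes {1..max m n}"
    using assms(2) permutes_subset[of \<sigma> "{1..n}"] by (simp add: Sym_def)
  then have "\<sigma> \<in> Sym (max m n)" by (simp add: Sym_def)
  moreover have "u \<in> L (max m n)" using m chain(4)[of m "max m n"] by auto
  ultimately have "act \<sigma> u \<in> L (max m n)" using chain(3) m(1) by simp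
  moreover have "max m n \<in> {1..}" using m(1) by simp
  ultimately show ?thesis unfolding chain_limit_def by blast
qed

text \<open>This allows \<open>finite_equivariant_generation\<close> to be applied to the saturated
  chain as well as to the original one.\<close>

lemma sym_inv_chain_saturation:
  assumes "sym_inv_chain d c L"
  shows "sym_inv_chain d c (\<lambda>n. chain_limit L \<inter> ZIn d c n)"
proof -
  have "is_lattice (ZIn d c n)" for n
    by (auto simp: is_lattice_def ZIn_def supp_def subset_iff) (metis add.right_neutral)
  then have "is_lattice (chain_limit L \<inter> ZIn d c n)" for n
    using is_lattice_chain_limit[OF assms] by (simp add: is_lattice_def)
  moreover have "ZIn d c m \<subseteq> ZIn d c n" if "m \<le> n" for m n
    using that by (fastforce simp: ZIn_def Idx_n_def)
  ultimately show ?thesis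
    unfolding sym_inv_chain_def
    using act_in_chain_limit[OF assms] act_in_ZIn by blast
qed

text \<open>The saturated chain is generated, from some p on, by finitely many vectors of the limit.
  These all lie in a single \<open>L r\<close>, so for n \<ge> max p r their translates, and hence
  the whole saturation at n, already lie in \<open>L n\<close>.\<close>

lemma eventually_saturated:
  assumes "sym_inv_chain d c L"
  shows "\<exists>q\<ge>1. \<forall>n\<ge>q. L n = chain_limit L \<inter> ZIn d c n"
proof -
  note chain = sym_inv_chainD[OF assms]
  obtain p B where p: "p \<ge> 1" "finite B" "B \<subseteq> chain_limit L"
    "\<And>n. n \<ge> p \<Longrightarrow> chain_limit L \<inter> ZIn d c n = zspan (orbit (Sym n) B)"
    using finite_equivariant_generation[OF sym_inv_chain_saturation[OF assms]] by blast
  obtain r where r: "r \<ge> 1" "B \<subseteq> L r" using finite_subset_chain_limit[OF assms p(2,3)] by blast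
  have "L n = chain_limit L \<inter> ZIn d c n" if "n \<ge> max p r" for n
  proof
    show "L n \<subseteq> chain_limit L \<inter> ZIn d c n"
      using that p(1) chain(1)[of n] unfolding chain_limit_def by force
    have "B \<subseteq> L n" using r chain(4)[of r n] that by auto
    then show "chain_limit L \<inter> ZIn d c n \<subseteq> L n"
      using p(1,4) that zspan_orbit_subset[OF assms, of n B] by simp
  qed
  then show ?thesis using p(1) by (intro exI[of _ "max p r"]) auto
qed

section \<open>The four conditions, each established directly from one finite generating set\<close>

theorem theorem3p6:
  fixes c d :: nat and L :: "nat \<Rightarrow> zvec set"
  assumes "c \<ge> 1" and "d \<ge> 1" and "sym_inv_chain d c L"
  shows "((\<exists>p\<ge>1. \<forall>m n. p \<le> m \<longrightarrow> m \<le> n \<longrightarrow> L n = zspan (orbit (Sym n) (L m)))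
       \<longleftrightarrow> (\<exists>p\<ge>1. \<exists>B. eq_gen_set_n p B (L p) \<and> (\<forall>n\<ge>p. eq_gen_set_n n B (L n))))
   \<and> ((\<exists>p\<ge>1. \<exists>B. eq_gen_set_n p B (L p) \<and> (\<forall>n\<ge>p. eq_gen_set_n n B (L n)))
       \<longleftrightarrow> (\<exists>q\<ge>1. \<exists>q'\<ge>1. \<forall>n\<ge>q. L n = chain_limit L \<inter> ZIn d c n \<and>
              (\<exists>G\<subseteq>L n. (\<forall>u\<in>G. supp_size u \<le> q') \<and> zspan G = L n)))
   \<and> ((\<exists>q\<ge>1. \<exists>q'\<ge>1. \<forall>n\<ge>q. L n = chain_limit L \<inter> ZIn d c n \<and>
              (\<exists>G\<subseteq>L n. (\<forall>u\<in>G. supp_size u \<le> q') \<and> zspan G = L n))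
       \<longleftrightarrow> (\<exists>B. finite B \<and> eq_gen_set B (chain_limit L)))"
    (is "(?i \<longleftrightarrow> ?ii) \<and> (?ii \<longleftrightarrow> ?iii) \<and> (?iii \<longleftrightarrow> ?iv)")
proof -
  note chain = sym_inv_chainD[OF assms(3)]
  obtain p B where p: "p \<ge> 1" "finite B" "B \<subseteq> L p"
    and gen: "\<And>n. n \<ge> p \<Longrightarrow> L n = zspan (orbit (Sym n) B)"
    using finite_equivariant_generation[OF assms(3)] by metis
  have B: "B \<subseteq> L n" if "n \<ge> p" for n using p chain(4) that by blast
  have ?ii
    using p(1) gen B by (intro exI[of _ p] conjI exI[of _ B]) (auto simp: eq_gen_set_n_def)
  moreover have ?i
  proof (intro exI[of _ p] conjI p(1) allI impI)
    fix m n assume mn: "p \<le> m" "m \<le> n"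
    \<comment> \<open>Since \<open>B\<close> is contained in \<open>L m\<close>, the translates of
      \<open>L m\<close> include those of \<open>B\<close>, which already span
      \<open>L n\<close>.\<close>
    have "L n \<subseteq> zspan (orbit (Sym n) (L m))"
      using gen[of n] mn zspan_mono[OF orbit_mono[OF subset_refl B[OF mn(1)]]] by simp
    moreover have "zspan (orbit (Sym n) (L m)) \<subseteq> L n"
      using zspan_orbit_subset[OF assms(3)] chain(4)[of m n] mn p(1) by simp
    ultimately show "L n = zspan (orbit (Sym n) (L m))" by blast
  qed
  moreover have ?iii
  proof -
    obtain q where q: "q \<ge> 1" "\<And>n. n \<ge> q \<Longrightarrow> L n = chain_limit L \<inter> ZIn d c n"
      using eventually_saturated[OF assms(3)] by blast
    \<comment> \<open>Translation does not enlarge supports, so the largest support size in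
      \<open>B\<close> bounds the whole orbit for every n. Inserting 1 ensures that q' is positive
      even if \<open>B\<close> is empty or contains only 0.\<close>
    define q' where "q' = Max (insert 1 (supp_size ` B))"
    have small: "supp_size u \<le> q'" if u: "u \<in> orbit (Sym n) B" for u n
    proof -
      obtain \<sigma> v where v: "\<sigma> \<in> Sym n" "v \<in> B" "u = act \<sigma> v" using u unfolding orbit_def by blast
      have "finite (supp v)" using v(2) p chain(1) finite_supp_ZIn by blast
      then have "supp_size u \<le> supp_size v" using supp_size_act_le v by simp
      also have "\<dots> \<le> q'" using v(2) p(2) by (simp add: q'_def)
      finally show ?thesis .
    qed
    have "orbit (Sym n) B \<subseteq> zspan (orbit (Sym n) B)" for n
      by (auto intro: zspan.gen)
    then have G: "\<exists>G\<subseteq>L n. (\<forall>u\<in>G. supp_size u \<le> q') \<and> zspan G = L n" if "n \<ge> p" for n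
      using small gen[OF that] that by (intro exI[of _ "orbit (Sym n) B"]) simp
    have "1 \<le> max p q" using p(1) by simp
    moreover have "1 \<le> q'" using p(2) by (simp add: q'_def)
    moreover have "\<forall>n\<ge>max p q. L n = chain_limit L \<inter> ZIn d c n \<and>
        (\<exists>G\<subseteq>L n. (\<forall>u\<in>G. supp_size u \<le> q') \<and> zspan G = L n)"
      by (intro allI impI conjI q(2) G) simp_all
    ultimately show ?thesis by (intro exI conjI)
  qed
  moreover have ?iv
  proof (intro exI[of _ B] conjI p(2))
    have Bl: "B \<subseteq> chain_limit L" using p by (auto simp: chain_limit_def)
    have "orbit SymAll B \<subseteq> chain_limit L"
      using Bl act_in_chain_limit[OF assms(3)] by (auto simp: orbit_def SymAll_def)
    then have "zspan (orbit SymAll B) \<subseteq> chain_limit L"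
      by (rule zspan_subset_lattice[OF is_lattice_chain_limit[OF assms(3)]])
    moreover have "L n \<subseteq> zspan (orbit SymAll B)" if "n \<ge> 1" for n
    proof -
      \<comment> \<open>Generation by \<open>B\<close> is known only from p on, so smaller levels
        are first embedded in \<open>L (max p n)\<close>.\<close>
      have "L n \<subseteq> L (max p n)" using chain(4) that by simp
      also have "\<dots> = zspan (orbit (Sym (max p n)) B)" using gen by simp
      also have "\<dots> \<subseteq> zspan (orbit SymAll B)"
        using p(1) by (intro zspan_mono orbit_mono) (auto simp: SymAll_def intro!: bexI[of _ "max p n"])
      finally show ?thesis .
    qed
    ultimately show "eq_gen_set B (chain_limit L)"
      using Bl by (auto simp: eq_gen_set_def chain_limit_def)
  qed
  ultimately show ?thesis by blast
qed

end
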